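(* Let $n\ge 3$ and let $f$ be an $n$-gon center function with coordinate map $\varphi_f$. Then the following hold (for all $n$-gons for which the objects involved are defined). P1 (the coordinate map is well defined). The coordinates given by $\varphi_f$ are associated to each polygon independently of the labelling, up to the corresponding re-ordering: for every $n$-gon $(V_1,\ldots,V_n)$ and every $\alpha\in D_n$, if $\varphi_f(V_1,\ldots,V_n)=[t_1:\ldots:t_n]$, then $\varphi_f(V_{\alpha(1)},\ldots,V_{\alpha(n)})=[t_{\alpha(1)}:\ldots:t_{\alpha(n)}]$. P2 (coherence with respect to similarities). Let $N_1=(V_1,\ldots,V_n)$ and $N_2=(V_1',\ldots,V_n')$ be two similar $n$-gons, and let $S$ be a similarity of the plane with $N_1=S(N_2)$, i.e. $V_i=S(V_i')$ for all $i$. Let $P_1,P_2$ be the points with barycentric coordinates $\varphi_f(V_1,\ldots,V_n)$ with respect to $N_1$ and $\varphi_f(V_1',\ldots,V_n')$ with respect to $N_2$, respectively. Then $P_1=S(P_2)$.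
   Context: An $n$-gon is identified with a tuple $(V_1,\ldots,V_n)$ of points of $\mathbb R^2$ (its labelled vertices), the edges being the segments $V_iV_{i+1}$ (indices mod $n$, taken in $\{1,\ldots,n\}$). The set of all $n$-gons is $\mathcal P_n\approx(\mathbb R^2)^n$; center functions may also be considered on a restricted domain, such as the non-degenerated $n$-gons (no two vertices coincide) or the convex $n$-gons; in that case the identities below are required for $n$-gons in the domain. $D_n=\langle\rho,\sigma:\rho^n=\sigma^2=id,\ \sigma\rho\sigma=\rho^{-1}\rangle$ is the dihedral group of order $2n$, viewed as a group of permutations of $\{1,\ldots,n\}$ via $\rho(i)=i+1 \bmod n$, $\sigma(i)=2+n-i \bmod n$ (so $\sigma(1)=1$). An $n$-gon center function is a real-valued function $f(V_1,\ldots,V_n)$ such that: (1) $f(V_1,V_2,\ldots,V_n)=f(V_1,V_{\sigma(2)},\ldots,V_{\sigma(n)})$; (2) there is $k\in\mathbb N$ (with $0\in\mathbb N$) such that $f(tV_1,\ldots,tV_n)=t^kf(V_1,\ldots,V_n)$ for all $t\in\mathbb R_{\ge 0}$; (3) $f(T(V_1),\ldots,T(V_n))=f(V_1,\ldots,V_n)$ for every rigid motion (isometry) $T$ of the plane. Its coordinate map, with values in the real projective space $P_{n-1}\mathbb R$, is $$\varphi_f(V_1,\ldots,V_n)=[f(V_1,\ldots,V_n):f(V_2,\ldots,V_n,V_1):\ldots:f(V_n,V_1,\ldots,V_{n-1})],$$ which is undefined when all these entries are zero. The point with barycentric coordinates $[t_1:\ldots:t_n]$ with respect to $(V_1,\ldots,V_n)$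 is $\widetilde t_1V_1+\ldots+\widetilde t_nV_n$, where $(\widetilde t_1,\ldots,\widetilde t_n)$ is the representative of $[t_1:\ldots:t_n]$ normalized by $\widetilde t_1+\ldots+\widetilde t_n=1$ (when such a normalization exists). *)

theory Defs
  imports "HOL-Analysis.Analysis" "HOL-Algebra.Sym_Groups"
begin

section \<open>Labelled polygons and the dihedral group\<close>

type_synonym point = "real ^ 2"

text \<open>An \<open>n\<close>-tuple is a function that is \<open>undefined\<close> outside \<open>{1..n}\<close>, so that equality of
  functions is equality of tuples.\<close>

definition tuples :: "nat \<Rightarrow> (nat \<Rightarrow> 'a) set"
  where "tuples n = {1..n} \<rightarrow>\<^sub>E UNIV"

abbreviation polygons :: "nat \<Rightarrow> (nat \<Rightarrow> point) set"
  where "polygons n \<equiv> tuples n"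

definition relabel :: "nat \<Rightarrow> (nat \<Rightarrow> nat) \<Rightarrow> (nat \<Rightarrow> 'a) \<Rightarrow> (nat \<Rightarrow> 'a)"
  where "relabel n \<alpha> x = (\<lambda>i\<in>{1..n}. x (\<alpha> i))"

definition map_polygon :: "nat \<Rightarrow> (point \<Rightarrow> point) \<Rightarrow> (nat \<Rightarrow> point) \<Rightarrow> (nat \<Rightarrow> point)"
  where "map_polygon n T V = (\<lambda>i\<in>{1..n}. T (V i))"

text \<open>The representative of \<open>m\<close> modulo \<open>n\<close> in \<open>{1..n}\<close>.\<close>

definition cyc :: "nat \<Rightarrow> nat \<Rightarrow> nat"
  where "cyc n m = (if n dvd m then n else m mod n)"

text \<open>Elements of \<^term>\<open>sym_group n\<close> are permutations of the whole type that fix every point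
  outside \<open>{1..n}\<close>; hence the case distinctions.\<close>

definition rho :: "nat \<Rightarrow> nat \<Rightarrow> nat"
  where "rho n i = (if i \<in> {1..n} then cyc n (i + 1) else i)"

definition sigma :: "nat \<Rightarrow> nat \<Rightarrow> nat"
  where "sigma n i = (if i \<in> {1..n} then cyc n (2 + n - i) else i)"

definition dihedral :: "nat \<Rightarrow> (nat \<Rightarrow> nat) set"
  where "dihedral n = generate (sym_group n) {rho n, sigma n}"


section \<open>Isometries and similarities of the plane\<close>

definition rigid_motion :: "(point \<Rightarrow> point) \<Rightarrow> bool"
  where "rigid_motion T \<longleftrightarrow> (\<forall>x y. dist (T x) (T y) = dist x y)"

definition similarity :: "(point \<Rightarrow> point) \<Rightarrow> bool"
  where "similarity S \<longleftrightarrow> (\<exists>r>0. \<forall>x y. dist (S x) (S y) = r * dist x y)"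


section \<open>Center functions\<close>

text \<open>The sets of \<open>n\<close>-gons on which the identities defining a center function make sense:
  for instance all \<open>n\<close>-gons, the non-degenerate ones, or the convex ones.  Only positive
  scaling factors are required here, since scaling by \<open>0\<close> leaves the latter two sets.\<close>

definition polygon_domain :: "nat \<Rightarrow> (nat \<Rightarrow> point) set \<Rightarrow> bool"
  where "polygon_domain n D \<longleftrightarrow>
    D \<subseteq> polygons n \<and>
    (\<forall>V\<in>D. \<forall>\<alpha>\<in>dihedral n. relabel n \<alpha> V \<in> D) \<and>
    (\<forall>V\<in>D. \<forall>t>0. map_polygon n (\<lambda>x. t *\<^sub>R x) V \<in> D) \<and>
    (\<forall>V\<in>D. \<forall>T. rigid_motion T \<longrightarrow> map_polygon n T V \<in> D)"

text \<open>The guard in the homogeneity condition only matters for \<open>t = 0\<close>.  For \<open>t = k = 0\<close> the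
  convention is \<open>0 ^ 0 = 1\<close>.\<close>

definition center_function ::
    "nat \<Rightarrow> (nat \<Rightarrow> point) set \<Rightarrow> ((nat \<Rightarrow> point) \<Rightarrow> real) \<Rightarrow> bool"
  where "center_function n D f \<longleftrightarrow>
    (\<forall>V\<in>D. f V = f (relabel n (sigma n) V)) \<and>
    (\<exists>k::nat. \<forall>V\<in>D. \<forall>t\<ge>0. map_polygon n (\<lambda>x. t *\<^sub>R x) V \<in> D \<longrightarrow>
        f (map_polygon n (\<lambda>x. t *\<^sub>R x) V) = t ^ k * f V) \<and>
    (\<forall>V\<in>D. \<forall>T. rigid_motion T \<longrightarrow> f (map_polygon n T V) = f V)"


section \<open>Projective coordinates and barycentric coordinates\<close>

definition nonzero_tuples :: "nat \<Rightarrow> (nat \<Rightarrow> real) set"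
  where "nonzero_tuples n = {t \<in> tuples n. \<exists>i\<in>{1..n}. t i \<noteq> 0}"

definition proportional :: "nat \<Rightarrow> ((nat \<Rightarrow> real) \<times> (nat \<Rightarrow> real)) set"
  where "proportional n = {(s, t). s \<in> nonzero_tuples n \<and> t \<in> nonzero_tuples n \<and>
    (\<exists>c. c \<noteq> 0 \<and> (\<forall>i\<in>{1..n}. t i = c * s i))}"

text \<open>The point \<open>[t\<^sub>1 : \<dots> : t\<^sub>n]\<close>, an element of the projective space
  \<^term>\<open>nonzero_tuples n // proportional n\<close>.\<close>

definition homog :: "nat \<Rightarrow> (nat \<Rightarrow> real) \<Rightarrow> (nat \<Rightarrow> real) set"
  where "homog n t = proportional n `` {t}"

definition coord_tuple :: "nat \<Rightarrow> ((nat \<Rightarrow> point) \<Rightarrow> real) \<Rightarrow> (nat \<Rightarrow> point) \<Rightarrow> (nat \<Rightarrow> real)"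
  where "coord_tuple n f V = (\<lambda>i\<in>{1..n}. f (relabel n (rho n ^^ (i - 1)) V))"

definition coord_map ::
    "nat \<Rightarrow> ((nat \<Rightarrow> point) \<Rightarrow> real) \<Rightarrow> (nat \<Rightarrow> point) \<Rightarrow> (nat \<Rightarrow> real) set option"
  where "coord_map n f V =
    (if coord_tuple n f V \<in> nonzero_tuples n then Some (homog n (coord_tuple n f V)) else None)"

text \<open>The point with barycentric coordinates \<open>p\<close> with respect to \<open>V\<close>, where \<open>p\<close> is a point of
  projective space; \<open>None\<close> if \<open>p\<close> has no representative with coordinate sum \<open>1\<close>.\<close>

definition barycentric_point ::
    "nat \<Rightarrow> (nat \<Rightarrow> real) set \<Rightarrow> (nat \<Rightarrow> point) \<Rightarrow> point option"
  where "barycentric_point n p V =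
    (if \<exists>t\<in>p. (\<Sum>i=1..n. t i) = 1
     then Some (let t = (THE t. t \<in> p \<and> (\<Sum>i=1..n. t i) = 1) in \<Sum>i=1..n. t i *\<^sub>R V i)
     else None)"

end

theory Submission
  imports Defs "HOL-Number_Theory.Cong"
begin

text \<open>Both \<open>V \<circ> \<alpha> \<circ> \<rho>\<^bsup>i-1\<^esup>\<close> and \<open>V \<circ> \<rho>\<^bsup>\<alpha>(i)-1\<^esup>\<close> list the polygon starting at the
  vertex \<open>\<alpha>(i)\<close>, so they differ at most by the reflection \<open>\<sigma>\<close>, under which \<open>f\<close> is invariant.
  Hence the tuple of values of \<open>f\<close> commutes with relabelling, already before passing to
  projective space; it suffices to check this on \<open>\<rho>\<close> and \<open>\<sigma>\<close>.  For similarities, the tuple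
  is only multiplied by the power \<open>r\<^sup>k\<close> of the ratio, so the normalized coordinates agree, and
  similarities preserve affine combinations.\<close>

section \<open>The generators of the dihedral group\<close>

lemma cyc_in: "n > 0 \<Longrightarrow> cyc n m \<in> {1..n}"
  unfolding cyc_def by (auto simp: Suc_le_eq mod_greater_zero_iff_not_dvd less_imp_le)

lemma cyc_cong: "[int (cyc n m) = int m] (mod int n)"
  unfolding cyc_def by (auto simp: cong_def zmod_int)

text \<open>Two elements of \<open>{1..n}\<close> differ by less than \<open>n\<close>. Identities
  between labels thus reduce to congruences over the integers, where subtraction is not
  truncated.\<close>

lemma eq_if_cong_in_range:
  assumes "a \<in> {1..n}" "b \<in> {1..n}" "[int a = int b] (mod int n)"
  shows "a = b"
proof (rule ccontr)
  assume "a \<noteq> b"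
  moreover have "int n dvd int a - int b"
    using assms(3) by (simp add: cong_iff_dvd_diff)
  ultimately have "\<bar>int n\<bar> \<le> \<bar>int a - int b\<bar>"
    by (intro dvd_imp_le_int) auto
  then show False using assms(1,2) by auto
qed

lemma cyc_eqI: "a \<in> {1..n} \<Longrightarrow> [int a = int m] (mod int n) \<Longrightarrow> cyc n m = a"
  by (rule eq_if_cong_in_range[OF cyc_in]) (auto intro: cong_trans[OF cyc_cong] simp: cong_sym)

section \<open>The rotation and the reflection in residue arithmetic\<close>

lemma rho_in: "i \<in> {1..n} \<Longrightarrow> rho n i \<in> {1..n}"
  using cyc_in[of n] by (auto simp: rho_def)

lemma sigma_in: "i \<in> {1..n} \<Longrightarrow> sigma n i \<in> {1..n}"
  using cyc_in[of n] by (auto simp: sigma_def)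

lemma rho_funpow: "i \<in> {1..n} \<Longrightarrow> (rho n ^^ j) i = cyc n (i + j)"
proof (induction j)
  case 0
  then show ?case by (simp add: cyc_eqI)
next
  case (Suc j)
  then have "cyc n (i + j) \<in> {1..n}" by (intro cyc_in) auto
  moreover have "[int (cyc n (cyc n (i + j) + 1)) = int (i + j) + 1] (mod int n)"
    using cong_trans[OF cyc_cong[of n "cyc n (i + j) + 1"]] cong_add[OF cyc_cong cong_refl]
    by (metis of_nat_1 of_nat_add)
  then have "cyc n (i + j + 1) = cyc n (cyc n (i + j) + 1)"
    using Suc.prems by (intro cyc_eqI cyc_in) (auto simp: add_ac)
  ultimately show ?case using Suc by (simp add: rho_def)
qed

lemma rho_funpow_in: "i \<in> {1..n} \<Longrightarrow> (rho n ^^ j) i \<in> {1..n}"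
  using cyc_in[of n "i + j"] by (auto simp: rho_funpow)

lemma rho_funpow_outside: "i \<notin> {1..n} \<Longrightarrow> (rho n ^^ j) i = i"
  by (induction j) (auto simp: rho_def)

lemma rho_funpow_n: "rho n ^^ n = id"
proof
  fix i show "(rho n ^^ n) i = id i"
    by (cases "i \<in> {1..n}")
       (auto simp: rho_funpow rho_funpow_outside cong_def intro!: cyc_eqI)
qed

text \<open>Since \<open>i\<close> is at most \<open>n\<close>, the natural subtraction in
  \<open>sigma\<close> is a genuine one, and the summand \<open>n\<close> vanishes modulo
  \<open>n\<close>.\<close>

lemma int_sigma_cong:
  assumes "i \<in> {1..n}"
  shows "[int (sigma n i) = 2 - int i] (mod int n)"
proof -
  have "[int (sigma n i) = int (2 + n - i)] (mod int n)"
    using assms cyc_cong[of n "2 + n - i"] by (simp only: sigma_def if_True)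
  also have "int (2 + n - i) = (2 - int i) + int n"
    using assms by (simp add: of_nat_diff)
  also have "[\<dots> = 2 - int i] (mod int n)"
    by (simp add: cong_def)
  finally show ?thesis .
qed

lemma sigma_sigma: "sigma n \<circ> sigma n = id"
proof
  fix i show "(sigma n \<circ> sigma n) i = id i"
  proof (cases "i \<in> {1..n}")
    case True
    have "[2 - int (sigma n i) = 2 - (2 - int i)] (mod int n)"
      using True by (intro cong_diff int_sigma_cong) auto
    then have "[int (sigma n (sigma n i)) = int i] (mod int n)"
      using cong_trans[OF int_sigma_cong[OF sigma_in[OF True]]] by simp
    then show ?thesis
      using eq_if_cong_in_range[OF sigma_in[OF sigma_in[OF True]] True] by simp
  qed (auto simp: sigma_def)
qed

text \<open>The dihedral relation between a reflection and a power of the rotation, with the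
  exponent \<open>n - j\<close> standing for \<open>-j\<close>. Both sides are congruent to
  \<open>2 - i - j\<close> modulo \<open>n\<close>.\<close>

lemma sigma_rho_funpow:
  assumes "i \<in> {1..n}" "j \<le> n"
  shows "sigma n ((rho n ^^ j) i) = (rho n ^^ (n - j)) (sigma n i)"
proof (rule eq_if_cong_in_range)
  have "[int (sigma n ((rho n ^^ j) i)) = 2 - int (i + j)] (mod int n)"
    using assms(1) rho_funpow_in[OF assms(1), of j]
    by (intro cong_trans[OF int_sigma_cong] cong_diff) (auto simp: rho_funpow intro: cyc_cong[of n "i + j", simplified])
  also have "[2 - int (i + j) = (2 - int i) + int (n - j)] (mod int n)"
    using assms(2) by (simp add: cong_iff_dvd_diff of_nat_diff)
  also have "[(2 - int i) + int (n - j) = int (sigma n i + (n - j))] (mod int n)"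
    using cong_sym[OF int_sigma_cong[OF assms(1)]] by (auto intro: cong_add)
  also have "[int (sigma n i + (n - j)) = int ((rho n ^^ (n - j)) (sigma n i))] (mod int n)"
    unfolding rho_funpow[OF sigma_in[OF assms(1)]] by (rule cong_sym[OF cyc_cong])
  finally show "[int (sigma n ((rho n ^^ j) i)) = int ((rho n ^^ (n - j)) (sigma n i))] (mod int n)" .
qed (use assms in \<open>auto intro!: sigma_in rho_funpow_in simp del: atLeastAtMost_iff One_nat_def\<close>)

section \<open>Membership in the dihedral group and induction over it\<close>

lemma rho_permutes: "rho n permutes {1..n}"
proof (cases "n = 0")
  case True
  then have "rho n = id" by (auto simp: rho_def)
  then show ?thesis by (simp add: permutes_id)
next
  case False
  \<comment> \<open>From \<open>rho_funpow_n\<close>, the power \<open>rho n ^^ (n - 1)\<close> is a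
    two-sided inverse of \<open>rho n\<close>; the exponent makes sense because \<open>n\<close> is
    positive here.\<close>
  then have "rho n ^^ n = rho n \<circ> rho n ^^ (n - 1)" "rho n ^^ n = rho n ^^ (n - 1) \<circ> rho n"
    by (metis funpow.simps(2) Suc_pred' bot_nat_0.not_eq_extremum,
        metis funpow_Suc_right Suc_pred' bot_nat_0.not_eq_extremum)
  then have "bij (rho n)"
    by (metis o_bij rho_funpow_n)
  then show ?thesis
    by (auto simp: permutes_def bij_iff rho_def)
qed

lemma sigma_permutes: "sigma n permutes {1..n}"
  using o_bij[OF sigma_sigma sigma_sigma] by (auto simp: permutes_def bij_iff sigma_def)

lemma dihedral_permutes: "\<alpha> \<in> dihedral n \<Longrightarrow> \<alpha> permutes {1..n}"
  using group.generate_incl[OF sym_group_is_group, of "{rho n, sigma n}" n]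
    rho_permutes[of n] sigma_permutes[of n] sym_group_carrier[of \<alpha> n]
  by (auto simp: dihedral_def sym_group_carrier simp del: One_nat_def)

lemma rho_dihedral: "rho n \<in> dihedral n"
  by (auto simp: dihedral_def intro: generate.incl)

lemma comp_dihedral: "\<alpha> \<in> dihedral n \<Longrightarrow> \<beta> \<in> dihedral n \<Longrightarrow> \<alpha> \<circ> \<beta> \<in> dihedral n"
  unfolding dihedral_def using generate.eng[of \<alpha> "sym_group n" _ \<beta>] by (simp add: sym_group_mult)

lemma rho_funpow_dihedral: "rho n ^^ j \<in> dihedral n"
proof (induction j)
  case 0
  show ?case using generate.one[of "sym_group n" "{rho n, sigma n}"]
    by (simp only: dihedral_def sym_group_one funpow.simps)
next
  case (Suc j)
  then show ?case unfolding funpow.simps by (intro comp_dihedral rho_dihedral)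
qed

text \<open>The rule for \<open>generate\<close> has a case for inverses of generators. It is
  discharged here once and for all: the inverse of \<open>rho n\<close> is a power of
  \<open>rho n\<close>, and \<open>sigma n\<close> is its own inverse.\<close>

lemma dihedral_induct [consumes 2, case_names id rho sigma comp]:
  assumes "n > 0" "\<alpha> \<in> dihedral n"
    and "P id" "P (rho n)" "P (sigma n)"
    and comp: "\<And>\<alpha> \<beta>. \<lbrakk>\<alpha> \<in> dihedral n; \<beta> \<in> dihedral n; P \<alpha>; P \<beta>\<rbrakk> \<Longrightarrow> P (\<alpha> \<circ> \<beta>)"
  shows "P \<alpha>"
  using assms(2) unfolding dihedral_def
proof (induction rule: generate.induct)
  case one
  show ?case using assms(3) by (simp only: sym_group_one)
next
  case (incl h)
  then show ?case using assms by auto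
next
  case (inv h)
  interpret group "sym_group n" by (rule sym_group_is_group)
  \<comment> \<open>Closure under composition gives all powers of the rotation, in particular its
    inverse \<open>rho n ^^ (n - 1)\<close>.\<close>
  have pow: "P (rho n ^^ j)" for j
  proof (induction j)
    case 0
    show ?case using assms(3) by (simp only: funpow.simps)
  next
    case (Suc j)
    then show ?case unfolding funpow.simps
      by (intro comp rho_dihedral rho_funpow_dihedral assms(4))
  qed
  from inv consider "h = rho n" | "h = sigma n" by auto
  then show ?case
  proof cases
    case 1
    have "rho n ^^ (n - 1) \<circ> rho n = id"
      using rho_funpow_n[of n] funpow_Suc_right[of "n - 1" "rho n"] assms(1) by simp
    then have "inv\<^bsub>sym_group n\<^esub> rho n = rho n ^^ (n - 1)"
      by (intro inv_equality)
         (simp_all only: sym_group_mult sym_group_one sym_group_carrier rho_permutes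
           dihedral_permutes rho_funpow_dihedral)
    then show ?thesis using pow[of "n - 1"] 1 by (simp only:)
  next
    case 2
    have "inv\<^bsub>sym_group n\<^esub> sigma n = sigma n"
      by (intro inv_equality)
         (simp_all only: sym_group_mult sym_group_one sym_group_carrier sigma_permutes sigma_sigma)
    then show ?thesis using assms(5) 2 by (simp only:)
  qed
next
  case (eng h1 h2)
  then show ?case unfolding sym_group_mult by (intro comp) (simp_all only: dihedral_def)
qed

section \<open>Relabelling\<close>

text \<open>Relabelling acts from the right, so the order of the permutations is reversed. The
  premise keeps \<open>\<beta> i\<close> away from the labels at which a relabelled tuple is
  \<open>undefined\<close>.\<close>

lemma relabel_relabel:
  "(\<And>i. i \<in> {1..n} \<Longrightarrow> \<beta> i \<in> {1..n}) \<Longrightarrow>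
    relabel n \<beta> (relabel n \<alpha> x) = relabel n (\<alpha> \<circ> \<beta>) x"
  by (auto simp: relabel_def restrict_def simp del: atLeastAtMost_iff One_nat_def)

lemma relabel_cong:
  "(\<And>i. i \<in> {1..n} \<Longrightarrow> \<alpha> i = \<beta> i) \<Longrightarrow> relabel n \<alpha> x = relabel n \<beta> x"
  by (auto simp: relabel_def restrict_def)

lemma relabel_id: "x \<in> tuples n \<Longrightarrow> relabel n id x = x"
  by (auto simp: relabel_def tuples_def extensional_restrict PiE_def cong: restrict_cong)

lemma coord_tuple_in: "coord_tuple n f V \<in> tuples n"
  by (simp add: coord_tuple_def tuples_def)

lemma relabel_in: "relabel n \<alpha> x \<in> tuples n"
  by (simp add: relabel_def tuples_def)

lemma relabel_nonzero:
  assumes "\<alpha> permutes {1..n}" "t \<in> nonzero_tuples n"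
  shows "relabel n \<alpha> t \<in> nonzero_tuples n"
proof -
  obtain i where "i \<in> {1..n}" "t i \<noteq> 0"
    using assms(2) by (auto simp: nonzero_tuples_def)
  moreover from this obtain j where "j \<in> {1..n}" "\<alpha> j = i"
    using permutes_image[OF assms(1)] by (metis imageE)
  ultimately have "j \<in> {1..n}" "relabel n \<alpha> t j \<noteq> 0"
    by (auto simp: relabel_def)
  then show ?thesis by (auto simp only: nonzero_tuples_def relabel_in intro!: CollectI conjI bexI)
qed

section \<open>Equivariance of the tuple of values under relabelling\<close>

lemma coord_tuple_relabel_rho:
  assumes "n > 0" "V \<in> tuples n"
  shows "coord_tuple n f (relabel n (rho n) V) = relabel n (rho n) (coord_tuple n f V)"
proof -
  \<comment> \<open>The two arguments of \<open>f\<close> already agree as polygons: one more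
    rotation raises the exponent \<open>i - 1\<close> to \<open>i\<close>, which is
    \<open>rho n i - 1\<close> up to wrapping around.\<close>
  have "relabel n (rho n ^^ (i - 1)) (relabel n (rho n) V) = relabel n (rho n ^^ (rho n i - 1)) V"
    if i: "i \<in> {1..n}" for i
  \<comment> \<open>At \<open>i = n\<close> the exponents are \<open>n\<close> on the left and
    \<open>0\<close> on the right, and \<open>rho n ^^ n\<close> is the identity.\<close>
  proof (cases "i = n")
    case True
    then have "rho n i = 1" using assms(1) by (auto simp: rho_def intro!: cyc_eqI simp: cong_def)
    moreover have "rho n \<circ> rho n ^^ (n - 1) = id"
      using rho_funpow_n[of n] assms(1) by (metis Suc_pred' funpow.simps(2))
    ultimately show ?thesis using True
      by (simp add: relabel_relabel rho_funpow_in del: atLeastAtMost_iff One_nat_def)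
  next
    case False
    then have "rho n i = i + 1" using i by (auto simp: rho_def intro!: cyc_eqI)
    moreover have "rho n \<circ> rho n ^^ (i - 1) = rho n ^^ i"
      using i by (cases i) auto
    ultimately show ?thesis
      by (simp add: relabel_relabel rho_funpow_in del: atLeastAtMost_iff One_nat_def)
  qed
  then show ?thesis
    using rho_in[of _ n] by (auto simp: coord_tuple_def relabel_def restrict_def simp del: atLeastAtMost_iff One_nat_def)
qed

lemma center_function_sigma:
  assumes "center_function n D f" "V \<in> D"
  shows "f (relabel n (sigma n) V) = f V"
proof -
  have "\<forall>V\<in>D. f V = f (relabel n (sigma n) V)"
    using assms(1) unfolding center_function_def by (elim conjE)
  from bspec[OF this assms(2)] show ?thesis by (rule sym)
qed

text \<open>Here the polygons themselves differ by a reflection. The dihedral relation moves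
  \<open>sigma\<close> past the rotation to the outermost relabelling, where the symmetry of
  \<open>f\<close> absorbs it.\<close>

lemma coord_tuple_relabel_sigma:
  assumes "n > 0" "polygon_domain n D" "center_function n D f" "V \<in> D"
  shows "coord_tuple n f (relabel n (sigma n) V) = relabel n (sigma n) (coord_tuple n f V)"
proof -
  have "f (relabel n (rho n ^^ (i - 1)) (relabel n (sigma n) V))
      = f (relabel n (rho n ^^ (sigma n i - 1)) V)" if i: "i \<in> {1..n}" for i
  proof -
    let ?W = "relabel n (rho n ^^ (n - (i - 1))) V"
    have "relabel n (rho n ^^ (i - 1)) (relabel n (sigma n) V)
        = relabel n (sigma n \<circ> rho n ^^ (i - 1)) V"
      by (rule relabel_relabel) (rule rho_funpow_in)
    also have "\<dots> = relabel n (rho n ^^ (n - (i - 1)) \<circ> sigma n) V"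
      using i by (intro relabel_cong) (auto simp only: o_apply atLeastAtMost_iff intro!: sigma_rho_funpow)
    also have "\<dots> = relabel n (sigma n) ?W"
      by (rule relabel_relabel[symmetric]) (rule sigma_in)
    finally have W: "relabel n (rho n ^^ (i - 1)) (relabel n (sigma n) V) = relabel n (sigma n) ?W" .
    \<comment> \<open>The symmetry of \<open>f\<close> is assumed only on \<open>D\<close>, so the
      rotated polygon must be shown to lie there.\<close>
    have "?W \<in> D"
      using assms(2,4) rho_funpow_dihedral unfolding polygon_domain_def by blast
    then have "f (relabel n (sigma n) ?W) = f ?W"
      by (rule center_function_sigma[OF assms(3)])
    moreover have "rho n ^^ (n - (i - 1)) = rho n ^^ (sigma n i - 1)"
    \<comment> \<open>The exponents coincide except at \<open>i = 1\<close>, the fixed label of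
      \<open>sigma\<close>, where they are \<open>n\<close> and \<open>0\<close>.\<close>
    proof (cases "i = 1")
      case True
      then have "sigma n i = 1"
        using assms(1) by (auto simp: sigma_def cong_def intro!: cyc_eqI)
      then show ?thesis using True rho_funpow_n by simp
    next
      case False
      then have "sigma n i = 2 + n - i" using i by (auto simp: sigma_def intro!: cyc_eqI)
      then have "sigma n i - 1 = n - (i - 1)" using i by auto
      then show ?thesis by simp
    qed
    ultimately show ?thesis by (simp only: W)
  qed
  then show ?thesis
    using sigma_in[of _ n]
    by (auto simp: coord_tuple_def relabel_def restrict_def simp del: atLeastAtMost_iff One_nat_def)
qed

lemma coord_tuple_relabel:
  assumes "n > 0" "polygon_domain n D" "center_function n D f" "V \<in> D" "\<alpha> \<in> dihedral n"
  shows "coord_tuple n f (relabel n \<alpha> V) = relabel n \<alpha> (coord_tuple n f V)"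
  using assms(1,5,4)
\<comment> \<open>In the composite case the hypothesis for \<open>\<beta>\<close> is applied to the
  polygon \<open>relabel n \<alpha> V\<close>, hence the generalization over
  \<open>V\<close>.\<close>
proof (induction arbitrary: V rule: dihedral_induct)
  case id
  then have "V \<in> tuples n"
    using assms(2) by (auto simp: polygon_domain_def)
  then show ?case by (simp only: relabel_id coord_tuple_in)
next
  case rho
  then show ?case
    using assms(1,2) by (intro coord_tuple_relabel_rho) (auto simp: polygon_domain_def)
next
  case sigma
  then show ?case by (rule coord_tuple_relabel_sigma[OF assms(1-3)])
next
  case (comp \<alpha> \<beta>)
  \<comment> \<open>Polymorphic in the entries: this is used both for polygons and for tuples of
    reals.\<close>
  have "relabel n \<beta> (relabel n \<alpha> x) = relabel n (\<alpha> \<circ> \<beta>) x" for x :: "nat \<Rightarrow> 'b"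
    using permutes_in_image[OF dihedral_permutes[OF comp(2)]] by (intro relabel_relabel) auto
  moreover have "relabel n \<alpha> V \<in> D"
    using assms(2) comp by (auto simp: polygon_domain_def)
  ultimately show ?case
    using comp by metis
qed

section \<open>Projective coordinates\<close>

lemma proportional_equiv: "equiv (nonzero_tuples n) (proportional n)"
proof (rule equivI)
  show "proportional n \<subseteq> nonzero_tuples n \<times> nonzero_tuples n"
    by (auto simp: proportional_def)
  show "refl_on (nonzero_tuples n) (proportional n)"
    by (auto simp: refl_on_def proportional_def intro!: exI[of _ "1::real"])
  show "sym (proportional n)"
  proof (rule symI)
    fix s t assume "(s, t) \<in> proportional n"
    then obtain c where "c \<noteq> 0" "\<forall>i\<in>{1..n}. t i = c * s i"
      "s \<in> nonzero_tuples n" "t \<in> nonzero_tuples n" by (auto simp: proportional_def)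
    then show "(t, s) \<in> proportional n"
      by (auto simp: proportional_def intro!: exI[of _ "1 / c"])
  qed
  show "trans (proportional n)"
  proof (rule transI)
    fix s t u assume "(s, t) \<in> proportional n" "(t, u) \<in> proportional n"
    then obtain c d where "c \<noteq> 0" "d \<noteq> 0" "\<forall>i\<in>{1..n}. t i = c * s i" "\<forall>i\<in>{1..n}. u i = d * t i"
      "s \<in> nonzero_tuples n" "u \<in> nonzero_tuples n" by (auto simp: proportional_def)
    then show "(s, u) \<in> proportional n"
      by (auto simp: proportional_def intro!: exI[of _ "d * c"])
  qed
qed

lemma homog_eqI: "(s, t) \<in> proportional n \<Longrightarrow> homog n s = homog n t"
  unfolding homog_def by (rule equiv_class_eq[OF proportional_equiv])

text \<open>Outside \<open>nonzero_tuples n\<close> the set \<open>homog n t\<close> is empty, so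
  equality of classes is informative only for a nonzero tuple.\<close>

lemma homog_eqD:
  "homog n s = homog n t \<Longrightarrow> t \<in> nonzero_tuples n \<Longrightarrow> (s, t) \<in> proportional n"
  unfolding homog_def by (rule eq_equiv_class[OF _ proportional_equiv])

lemma proportional_relabel:
  assumes "\<alpha> permutes {1..n}" "(s, t) \<in> proportional n"
  shows "(relabel n \<alpha> s, relabel n \<alpha> t) \<in> proportional n"
proof -
  obtain c where "c \<noteq> 0" "\<forall>i\<in>{1..n}. t i = c * s i"
    "s \<in> nonzero_tuples n" "t \<in> nonzero_tuples n" using assms(2) by (auto simp: proportional_def)
  moreover from this have "\<forall>i\<in>{1..n}. relabel n \<alpha> t i = c * relabel n \<alpha> s i"
    using permutes_in_image[OF assms(1)] by (simp add: relabel_def)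
  ultimately show ?thesis
    by (auto simp only: proportional_def relabel_nonzero[OF assms(1)])
qed

lemma coord_map_Some_iff:
  "coord_map n f V = Some p \<longleftrightarrow>
    coord_tuple n f V \<in> nonzero_tuples n \<and> p = homog n (coord_tuple n f V)"
  by (auto simp: coord_map_def)

text \<open>The representative \<open>t\<close> is arbitrary, whereas
  \<open>coord_tuple_relabel\<close> concerns the actual values of \<open>f\<close>; relabelling
  respects proportionality, which bridges the two.\<close>

lemma coord_map_relabel:
  assumes "n > 0" "polygon_domain n D" "center_function n D f" "V \<in> D" "\<alpha> \<in> dihedral n"
    and "coord_map n f V = Some (homog n t)"
  shows "coord_map n f (relabel n \<alpha> V) = Some (homog n (relabel n \<alpha> t))"
proof -
  have "coord_tuple n f V \<in> nonzero_tuples n" "homog n t = homog n (coord_tuple n f V)"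
    using assms(6) by (auto simp: coord_map_Some_iff)
  then have "coord_tuple n f V \<in> nonzero_tuples n" "(t, coord_tuple n f V) \<in> proportional n"
    by (auto intro: homog_eqD)
  then show ?thesis
    unfolding coord_map_Some_iff coord_tuple_relabel[OF assms(1-5)]
    using dihedral_permutes[OF assms(5)]
    by (intro conjI relabel_nonzero arg_cong[of _ _ Some] homog_eqI proportional_relabel) simp_all
qed

text \<open>The definite description is legitimate because proportional tuples with equal nonzero
  sums have factor \<open>1\<close>. The weights stay in the form of this description, which does
  not mention the polygon, so that they can be compared across polygons.\<close>

lemma barycentric_pointE:
  assumes "barycentric_point n (homog n x) V = Some P"
  obtains t where "t = (THE t. t \<in> homog n x \<and> (\<Sum>i=1..n. t i) = 1)"
    "(\<Sum>i=1..n. t i) = 1" "P = (\<Sum>i=1..n. t i *\<^sub>R V i)"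
proof -
  let ?t = "THE t. t \<in> homog n x \<and> (\<Sum>i=1..n. t i) = 1"
  obtain u where u: "u \<in> homog n x" "(\<Sum>i=1..n. u i) = 1"
    using assms by (auto simp: barycentric_point_def split: if_splits)
  have "\<exists>!t. t \<in> homog n x \<and> (\<Sum>i=1..n. t i) = 1"
  proof (rule ex1I)
    show "u \<in> homog n x \<and> (\<Sum>i=1..n. u i) = 1" using u by simp
    fix t assume t: "t \<in> homog n x \<and> (\<Sum>i=1..n. t i) = 1"
    then have "(u, t) \<in> proportional n"
      using u equivE[OF proportional_equiv]
      by (metis homog_def Image_singleton_iff symD transD)
    \<comment> \<open>Proportionality controls only the entries with index in \<open>{1..n}\<close>;
      membership in \<open>tuples n\<close> provides agreement elsewhere.\<close>
    then obtain c where "\<forall>i\<in>{1..n}. t i = c * u i"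
      and in_tuples: "t \<in> tuples n" "u \<in> tuples n"
      unfolding proportional_def nonzero_tuples_def by blast
    then have c: "\<And>i. i \<in> {1..n} \<Longrightarrow> t i = c * u i" by blast
    moreover have "c = 1"
      using t u by (simp add: c sum_distrib_left[symmetric])
    ultimately show "t = u"
      using in_tuples unfolding tuples_def by (intro PiE_ext) auto
  qed
  from theI'[OF this] have "(\<Sum>i=1..n. ?t i) = 1" by simp
  moreover have "P = (\<Sum>i=1..n. ?t i *\<^sub>R V i)"
    using assms by (auto simp: barycentric_point_def Let_def split: if_splits)
  ultimately show ?thesis using that by blast
qed

section \<open>Similarities\<close>

text \<open>Subtracting \<open>S 0\<close> gives a map that fixes the origin and scales distances,
  hence a linear one. As the weights sum to \<open>1\<close>, the constant \<open>S 0\<close>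
  cancels.\<close>

lemma similarity_affine_sum:
  assumes "similarity S" "finite A" "(\<Sum>i\<in>A. t i) = 1"
  shows "S (\<Sum>i\<in>A. t i *\<^sub>R x i) = (\<Sum>i\<in>A. t i *\<^sub>R S (x i))"
proof -
  obtain r where "\<forall>x y. dist (S x) (S y) = r * dist x y"
    using assms(1) by (auto simp: similarity_def)
  moreover have "dist (S x - S 0) (S y - S 0) = dist (S x) (S y)" for x y
    by (simp add: dist_norm)
  ultimately have "linear (\<lambda>x. S x - S 0)"
    by (intro scaling_linear[where c = r]) simp_all
  from linear_sum[OF this, of "\<lambda>i. t i *\<^sub>R x i" A]
  have "S (\<Sum>i\<in>A. t i *\<^sub>R x i) - S 0 = (\<Sum>i\<in>A. t i *\<^sub>R (S (x i) - S 0))"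
    using linear_scale[OF \<open>linear _\<close>] by simp
  also have "\<dots> = (\<Sum>i\<in>A. t i *\<^sub>R S (x i)) - S 0"
    using assms(3) by (simp add: scaleR_diff_right sum_subtractf flip: scaleR_sum_left)
  finally show ?thesis by simp
qed

lemma map_polygon_relabel:
  "(\<And>i. i \<in> {1..n} \<Longrightarrow> \<alpha> i \<in> {1..n}) \<Longrightarrow>
    relabel n \<alpha> (map_polygon n T V) = map_polygon n T (relabel n \<alpha> V)"
  by (auto simp: relabel_def map_polygon_def restrict_def simp del: atLeastAtMost_iff One_nat_def)

lemma center_function_rigid_motion:
  assumes "center_function n D f" "V \<in> D" "rigid_motion T"
  shows "f (map_polygon n T V) = f V"
proof -
  have "\<forall>V\<in>D. \<forall>T. rigid_motion T \<longrightarrow> f (map_polygon n T V) = f V"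
    using assms(1) unfolding center_function_def by (elim conjE)
  then show ?thesis using assms(2,3) by blast
qed

lemma center_function_homogeneous:
  assumes "center_function n D f"
  shows "\<exists>k::nat. \<forall>V\<in>D. \<forall>t\<ge>0. map_polygon n (\<lambda>x. t *\<^sub>R x) V \<in> D \<longrightarrow>
    f (map_polygon n (\<lambda>x. t *\<^sub>R x) V) = t ^ k * f V"
  using assms unfolding center_function_def by (elim conjE)

text \<open>A similarity of ratio \<open>r\<close> is the scaling by \<open>r\<close> followed by a
  rigid motion, so \<open>f\<close> is multiplied by \<open>r ^ k\<close>. This factor is the same
  for all polygons in \<open>D\<close>, and so for all relabellings of one polygon.\<close>

lemma center_function_similarity:
  assumes "polygon_domain n D" "center_function n D f" "similarity S"
  obtains c where "c \<noteq> 0" "\<And>V. V \<in> D \<Longrightarrow> f (map_polygon n S V) = c * f V"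
proof -
  obtain r where r: "r > 0" "\<And>x y. dist (S x) (S y) = r * dist x y"
    using assms(3) by (auto simp: similarity_def)
  obtain k where k: "\<And>V t. \<lbrakk>V \<in> D; t \<ge> 0; map_polygon n (\<lambda>x. t *\<^sub>R x) V \<in> D\<rbrakk> \<Longrightarrow>
      f (map_polygon n (\<lambda>x. t *\<^sub>R x) V) = t ^ k * f V"
    using center_function_homogeneous[OF assms(2)] by blast
  \<comment> \<open>The rigid factor: undo the scaling first, then apply \<open>S\<close>.\<close>
  let ?T = "\<lambda>x. S ((1 / r) *\<^sub>R x)"
  have "dist ((1 / r) *\<^sub>R x) ((1 / r) *\<^sub>R y) = (1 / r) * dist x y" for x y :: point
    unfolding dist_norm scaleR_diff_right[symmetric] norm_scaleR using r(1) by simp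
  then have T: "rigid_motion ?T"
    unfolding rigid_motion_def r(2) using r(1) by simp
  show ?thesis
  proof
    show "r ^ k \<noteq> 0" using r(1) by simp
    fix V assume V: "V \<in> D"
    let ?W = "map_polygon n (\<lambda>x. r *\<^sub>R x) V"
    have W: "?W \<in> D" using V r(1) assms(1) by (auto simp: polygon_domain_def)
    have "map_polygon n S V = map_polygon n ?T ?W"
      unfolding map_polygon_def using r(1) by (intro restrict_ext) simp
    then have "f (map_polygon n S V) = f ?W"
      by (simp only: center_function_rigid_motion[OF assms(2) W T])
    also have "\<dots> = r ^ k * f V" using V W r(1) by (intro k) auto
    finally show "f (map_polygon n S V) = r ^ k * f V" .
  qed
qed

text \<open>All entries are multiplied by one nonzero factor. This preserves the projective point as
  well as whether it is defined, so the equality of options covers the case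
  \<open>None\<close>.\<close>

lemma coord_map_similarity:
  assumes "polygon_domain n D" "center_function n D f" "similarity S" "V \<in> D"
  shows "coord_map n f (map_polygon n S V) = coord_map n f V"
proof -
  obtain c where c: "c \<noteq> 0" "\<And>V. V \<in> D \<Longrightarrow> f (map_polygon n S V) = c * f V"
    using center_function_similarity[OF assms(1-3)] by blast
  have "relabel n (rho n ^^ j) V \<in> D" for j
    using assms(1,4) rho_funpow_dihedral by (auto simp: polygon_domain_def)
  then have eq: "coord_tuple n f (map_polygon n S V) i = c * coord_tuple n f V i"
    if "i \<in> {1..n}" for i
    using that
    by (simp add: coord_tuple_def map_polygon_relabel[OF rho_funpow_in] c del: atLeastAtMost_iff One_nat_def)
  then have "coord_tuple n f (map_polygon n S V) \<in> nonzero_tuples n \<longleftrightarrow>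
      coord_tuple n f V \<in> nonzero_tuples n"
    using c(1) by (auto simp: nonzero_tuples_def coord_tuple_in)
  moreover have "homog n (coord_tuple n f V) = homog n (coord_tuple n f (map_polygon n S V))"
    if "coord_tuple n f V \<in> nonzero_tuples n"
    using that calculation c(1) eq by (intro homog_eqI) (auto simp: proportional_def)
  ultimately show ?thesis by (simp add: coord_map_def)
qed

text \<open>Both polygons are given the same projective point, so their normalized weights coincide
  and \<open>S\<close> preserves the affine combination.\<close>

lemma barycentric_point_similarity:
  assumes "similarity S" "\<And>i. i \<in> {1..n} \<Longrightarrow> V i = S (V' i)"
    and "barycentric_point n (homog n x) V = Some P1"
    and "barycentric_point n (homog n x) V' = Some P2"
  shows "P1 = S P2"
proof -
  obtain t where t: "t = (THE t. t \<in> homog n x \<and> (\<Sum>i=1..n. t i) = 1)"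
    "(\<Sum>i=1..n. t i) = 1" "P1 = (\<Sum>i=1..n. t i *\<^sub>R V i)"
    using barycentric_pointE[OF assms(3)] by blast
  obtain t' where t': "t' = (THE t. t \<in> homog n x \<and> (\<Sum>i=1..n. t i) = 1)"
    "P2 = (\<Sum>i=1..n. t' i *\<^sub>R V' i)"
    using barycentric_pointE[OF assms(4)] by blast
  have "t' = t" unfolding t(1) t'(1) by (rule refl)
  have "S P2 = (\<Sum>i=1..n. t i *\<^sub>R S (V' i))"
    unfolding t'(2) \<open>t' = t\<close> by (rule similarity_affine_sum[OF assms(1) _ t(2)]) simp
  also have "\<dots> = P1"
    unfolding t(3) by (rule sum.cong) (simp_all add: assms(2))
  finally show ?thesis by (rule sym)
qed

theorem theorem10:
  fixes n :: nat
    and D :: "(nat \<Rightarrow> point) set"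
    and f :: "(nat \<Rightarrow> point) \<Rightarrow> real"
  assumes "n \<ge> 3"
    and "polygon_domain n D"
    and "center_function n D f"
  shows "(\<forall>V\<in>D. \<forall>\<alpha>\<in>dihedral n. \<forall>t\<in>nonzero_tuples n.
            coord_map n f V = Some (homog n t) \<longrightarrow>
            coord_map n f (relabel n \<alpha> V) = Some (homog n (relabel n \<alpha> t))) \<and>
         (\<forall>V\<in>D. \<forall>V'\<in>D. \<forall>S p p' P1 P2.
            similarity S \<longrightarrow>
            (\<forall>i\<in>{1..n}. V i = S (V' i)) \<longrightarrow>
            coord_map n f V = Some p \<longrightarrow>
            coord_map n f V' = Some p' \<longrightarrow>
            barycentric_point n p V = Some P1 \<longrightarrow>
            barycentric_point n p' V' = Some P2 \<longrightarrow>
            P1 = S P2)"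
proof (intro conjI ballI allI impI)
  fix V \<alpha> t
  assume "V \<in> D" "\<alpha> \<in> dihedral n" "t \<in> nonzero_tuples n" "coord_map n f V = Some (homog n t)"
  then show "coord_map n f (relabel n \<alpha> V) = Some (homog n (relabel n \<alpha> t))"
    using assms(1) by (intro coord_map_relabel[OF _ assms(2,3)]) simp_all
next
  fix V V' S p p' P1 P2
  assume V: "V \<in> D" "V' \<in> D" and S: "similarity S" "\<forall>i\<in>{1..n}. V i = S (V' i)"
    and p: "coord_map n f V = Some p" "coord_map n f V' = Some p'"
    and P: "barycentric_point n p V = Some P1" "barycentric_point n p' V' = Some P2"
  \<comment> \<open>The vertices are known to correspond only on \<open>{1..n}\<close>;
    extensionality of both tuples turns this into equality of polygons.\<close>
  have "V \<in> {1..n} \<rightarrow>\<^sub>E UNIV"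
    using V(1) assms(2) unfolding polygon_domain_def tuples_def by blast
  moreover have "map_polygon n S V' \<in> {1..n} \<rightarrow>\<^sub>E UNIV"
    by (simp add: map_polygon_def)
  moreover have "V i = map_polygon n S V' i" if "i \<in> {1..n}" for i
    unfolding map_polygon_def restrict_apply'[OF that] by (rule bspec[OF S(2) that])
  ultimately have "V = map_polygon n S V'"
    by (rule PiE_ext)
  then have "coord_map n f V = coord_map n f V'"
    by (rule ssubst) (rule coord_map_similarity[OF assms(2,3) S(1) V(2)])
  then have "Some p = Some p'"
    unfolding p .
  moreover have x: "p = homog n (coord_tuple n f V)"
    using p(1) unfolding coord_map_Some_iff by (rule conjunct2)
  ultimately have x': "p' = homog n (coord_tuple n f V)"
    by (simp only: option.inject)
  show "P1 = S P2"
    by (rule barycentric_point_similarity[OF S(1) bspec[OF S(2)] P[unfolded x x']])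
qed

end
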